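(* Let $N, k, g, n$ be positive integers. Suppose there is a modular Golomb ruler with $k$ marks modulo $N$, and suppose $g\mid N$. If $$n\le k-\left\lfloor \frac{g}{2}\right\rfloor,\qquad n=ag+r,\qquad 0\le r<g,$$ with $a,r$ integers, then $$G(g,n)\le \frac Ng-\left\lceil \frac{\frac Ng+\frac{g a(a-1)}2+ra}{n}\right\rceil.$$ The same bound is valid for every larger target multiplicity: for every integer $g'\ge g$, $G(g',n)$ is at most the same right-hand side (computed with the original $g,a,r$).
   Context: A finite set $\mathcal{G}\subset\mathbb{Z}$ is a $g$-Golomb ruler if for every positive integer $d$ the number of pairs $(a,c)\in \mathcal{G}^2$ with $c-a=d$ is at most $g$. $G(g,n)$ denotes the minimum possible diameter (largest element minus smallest element) of a $g$-Golomb ruler with exactly $n$ elements (marks). A set $\mathcal{A}$ of residues modulo $N$ is a modular $g$-Golomb ruler modulo $N$ if every nonzero residue modulo $N$ occurs at most $g$ times as a difference $a-a' \pmod N$ with $(a,a')$ an ordered pair of distinct elements of $\mathcal{A}$; its elements are called marks. A modular Golomb ruler is a modular $1$-Golomb ruler. *)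

theory Defs
  imports Complex_Main
begin

definition golomb_ruler :: "nat \<Rightarrow> int set \<Rightarrow> bool" where
  "golomb_ruler g S \<longleftrightarrow>
     finite S \<and> (\<forall>d>0. card {(a, c) \<in> S \<times> S. c - a = d} \<le> g)"

definition diameter :: "int set \<Rightarrow> int" where
  "diameter S = Max S - Min S"

text \<open>
  The minimum is taken over natural numbers, since the diameter of a finite nonempty set
  is nonnegative. It is a genuine minimum for positive \<open>g\<close> and \<open>n\<close>: see
  \<open>golomb_G_attained\<close> below.
\<close>
definition golomb_G :: "nat \<Rightarrow> nat \<Rightarrow> nat" where
  "golomb_G g n =
     (LEAST m. \<exists>S. golomb_ruler g S \<and> card S = n \<and> diameter S = int m)"

text \<open>Residues modulo \<open>N\<close> are represented by the integers \<open>0, \<dots>, N - 1\<close>.\<close>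
definition modular_golomb_ruler :: "nat \<Rightarrow> nat \<Rightarrow> int set \<Rightarrow> bool" where
  "modular_golomb_ruler g N A \<longleftrightarrow>
     A \<subseteq> {0..<int N} \<and>
     (\<forall>d\<in>{1..<int N}.
        card {(a, a') \<in> A \<times> A. a \<noteq> a' \<and> (a - a') mod int N = d} \<le> g)"

lemma golomb_ruler_exists:
  assumes "g > 0"
  shows "\<exists>S. golomb_ruler g S \<and> card S = n"
proof -
  define P :: "int set \<Rightarrow> bool" where
    "P = (\<lambda>S. \<forall>a\<in>S. \<forall>c\<in>S. \<forall>a'\<in>S. \<forall>c'\<in>S.
       a < c \<longrightarrow> c - a = c' - a' \<longrightarrow> a = a' \<and> c = c')"
  have "\<exists>S M. finite S \<and> card S = n \<and> S \<subseteq> {0..M} \<and> P S" for n :: nat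
  proof (induction n)
    case 0
    have "P {}"
      by (simp add: P_def)
    then show ?case
      by (intro exI[of _ "{}"]) simp
  next
    case (Suc n)
    then obtain S M where S: "finite S" "card S = n" "S \<subseteq> {0..M}" and "P S"
      by blast
    define z where "z = 2 * \<bar>M\<bar> + 1"
    have b: "0 \<le> x \<and> 2 * x < z" if "x \<in> S" for x
    proof -
      have "0 \<le> x" "x \<le> M"
        using S(3) that by auto
      then show ?thesis
        unfolding z_def by linarith
    qed
    have "z > 0"
      by (simp add: z_def)
    then have z: "z \<notin> S"
      using b[of z] by linarith
    have "P (insert z S)"
      unfolding P_def
    proof (intro ballI impI)
      fix a c a' c'
      assume in_S: "a \<in> insert z S" "c \<in> insert z S" "a' \<in> insert z S" "c' \<in> insert z S"
        and less: "a < c" and eq: "c - a = c' - a'"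
      have le: "0 \<le> x \<and> x \<le> z" if "x \<in> insert z S" for x
        using that b[of x] \<open>z > 0\<close> by (cases "x = z") simp_all
      have a: "a \<in> S" "a' \<in> S"
        using in_S le[OF in_S(2)] le[OF in_S(4)] less eq by auto
      show "a = a' \<and> c = c'"
      proof (cases "c = z \<or> c' = z")
        case True
        have "c = c'"
        proof (rule ccontr)
          assume "c \<noteq> c'"
          then consider "c = z" "c' \<in> S" | "c' = z" "c \<in> S"
            using True in_S by blast
          then show False
            by cases (use a[THEN b] b[of c] b[of c'] eq in linarith)+
        qed
        with eq show ?thesis by simp
      next
        case False
        then have "c \<in> S" "c' \<in> S"
          using in_S by simp_all
        with a less eq \<open>P S\<close> show ?thesis
          unfolding P_def by metis
      qed
    qed
    moreover have "finite (insert z S)" "card (insert z S) = Suc n"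
      using S z by simp_all
    moreover have "insert z S \<subseteq> {0..z}"
    proof
      fix x assume "x \<in> insert z S"
      then show "x \<in> {0..z}"
        using b[of x] \<open>z > 0\<close> by (cases "x = z") simp_all
    qed
    ultimately show ?case
      by blast
  qed
  from this[of n] obtain S where S: "finite S" "card S = n" and "P S"
    by blast
  have "card {(a, c) \<in> S \<times> S. c - a = d} \<le> g" if "d > 0" for d
  proof -
    have fin: "finite {(a, c) \<in> S \<times> S. c - a = d}"
      by (rule finite_subset[of _ "S \<times> S"]) (use S in auto)
    have "p = q" if p: "p \<in> {(a, c) \<in> S \<times> S. c - a = d}"
      and q: "q \<in> {(a, c) \<in> S \<times> S. c - a = d}" for p q
    proof -
      have "fst p \<in> S" "snd p \<in> S" "fst q \<in> S" "snd q \<in> S"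
        "fst p < snd p" "snd p - fst p = snd q - fst q"
        using p q \<open>d > 0\<close> by (simp_all add: case_prod_beta mem_Times_iff)
      then have "fst p = fst q \<and> snd p = snd q"
        using \<open>P S\<close> unfolding P_def by metis
      then show ?thesis
        by (simp add: prod_eq_iff)
    qed
    then have "card {(a, c) \<in> S \<times> S. c - a = d} \<le> Suc 0"
      unfolding card_le_Suc0_iff_eq[OF fin] by blast
    with assms show ?thesis by linarith
  qed
  with S show ?thesis
    unfolding golomb_ruler_def by blast
qed

lemma golomb_G_attained:
  assumes "g > 0" "n > 0"
  shows "\<exists>S. golomb_ruler g S \<and> card S = n \<and> diameter S = int (golomb_G g n)"
proof -
  obtain S where S: "golomb_ruler g S" "card S = n"
    using golomb_ruler_exists[OF assms(1)] by blast
  then have fin: "finite S" and "S \<noteq> {}"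
    using assms(2) by (auto simp: golomb_ruler_def)
  then have "Min S \<le> Max S"
    using Min_le Max_in by blast
  then have "\<exists>m. diameter S = int m"
    unfolding diameter_def by (intro exI[of _ "nat (Max S - Min S)"]) simp
  with S have "\<exists>m S. golomb_ruler g S \<and> card S = n \<and> diameter S = int m"
    by blast
  then show ?thesis
    unfolding golomb_G_def by (rule LeastI_ex)
qed

end

theory Submission
  imports Defs
begin

text \<open>
  Reduce the modular Golomb ruler modulo \<open>M = N / g\<close>. Two marks that collide have a difference in
  \<open>{M, 2M, \<dots>, (g - 1)M}\<close>, and each of these differences occurs at most once, so deleting at most
  \<open>g / 2\<close> marks makes the reduction injective; a nonzero residue modulo \<open>M\<close> has \<open>g\<close> lifts modulo
  \<open>N\<close>, so the result is a modular \<open>g\<close>-Golomb ruler modulo \<open>M\<close>. Its \<open>n\<close> cyclic gaps add up to \<open>M\<close>,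
  and each value is a gap at most \<open>g\<close> times, so the largest gap \<open>D\<close> satisfies
  \<open>M \<le> g D + g (D - 1) + \<dots> + g (D - a + 1) + r (D - a) = n D - (g a (a - 1) / 2 + r a)\<close>.
  Cutting the circle at that gap leaves a \<open>g\<close>-Golomb ruler of diameter at most \<open>M - D\<close>.
\<close>

section \<open>Monotonicity and differences of residues\<close>

lemma golomb_ruler_mono:
  assumes "golomb_ruler g S" "g \<le> g'"
  shows "golomb_ruler g' S"
  using assms(1) by (auto simp: golomb_ruler_def intro: order_trans[OF _ assms(2)])

lemma golomb_G_le:
  assumes "golomb_ruler g S" "card S = n" "n > 0" "diameter S \<le> m"
  shows "int (golomb_G g n) \<le> m"
proof -
  have "finite S" "S \<noteq> {}"
    using assms by (auto simp: golomb_ruler_def)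
  then have "0 \<le> diameter S"
    unfolding diameter_def by simp
  then have "golomb_G g n \<le> nat (diameter S)"
    unfolding golomb_G_def using assms by (intro Least_le) auto
  with \<open>0 \<le> diameter S\<close> assms(4) show ?thesis by linarith
qed

lemma modular_golomb_ruler_subset:
  assumes "modular_golomb_ruler g N A" "B \<subseteq> A"
  shows "modular_golomb_ruler g N B"
proof -
  have fin: "finite A"
    using assms(1) finite_subset by (auto simp: modular_golomb_ruler_def)
  have "card {(a, a') \<in> B \<times> B. a \<noteq> a' \<and> (a - a') mod int N = d}
      \<le> card {(a, a') \<in> A \<times> A. a \<noteq> a' \<and> (a - a') mod int N = d}" for d
    by (rule card_mono, rule finite_subset[of _ "A \<times> A"]) (use fin assms(2) in auto)
  with assms show ?thesis
    unfolding modular_golomb_ruler_def by (meson order_trans)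
qed

lemma mod_diff_pos:
  fixes x y m :: int
  assumes "x \<in> {0..<m}" "y \<in> {0..<m}" "x \<noteq> y"
  shows "(x - y) mod m \<in> {1..<m}"
proof -
  have "(x - y) mod m \<noteq> 0"
  proof
    assume "(x - y) mod m = 0"
    then have "x mod m = y mod m"
      by (simp add: mod_eq_dvd_iff mod_eq_0_iff_dvd)
    with assms show False by simp
  qed
  moreover have "0 \<le> (x - y) mod m" "(x - y) mod m < m"
    using assms by (auto intro!: pos_mod_sign pos_mod_bound)
  ultimately show ?thesis by simp
qed

text \<open>Multiplicity one, recast so that it gives injectivity of the difference map on sets of
  ordered pairs of distinct marks.\<close>

lemma modular_golomb_ruler_1_unique:
  assumes A: "modular_golomb_ruler 1 N A"
    and in_A: "a \<in> A" "b \<in> A" "c \<in> A" "d \<in> A" and "a \<noteq> b" "c \<noteq> d"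
    and eq: "(a - b) mod int N = (c - d) mod int N"
  shows "a = c \<and> b = d"
proof -
  let ?P = "{(x, y) \<in> A \<times> A. x \<noteq> y \<and> (x - y) mod int N = (c - d) mod int N}"
  have sub: "A \<subseteq> {0..<int N}"
    using A by (simp add: modular_golomb_ruler_def)
  then have fin: "finite ?P"
    by (intro finite_subset[of ?P "{0..<int N} \<times> {0..<int N}"]) auto
  have "(c - d) mod int N \<in> {1..<int N}"
    using in_A sub \<open>c \<noteq> d\<close> by (intro mod_diff_pos) auto
  then have "card ?P \<le> Suc 0"
    using A by (simp add: modular_golomb_ruler_def)
  then have "\<forall>p\<in>?P. \<forall>q\<in>?P. p = q"
    unfolding card_le_Suc0_iff_eq[OF fin] .
  moreover have "(a, b) \<in> ?P" "(c, d) \<in> ?P"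
    using assms by auto
  ultimately show ?thesis by blast
qed

text \<open>Source of the factor \<open>g\<close>: a residue modulo \<open>m\<close> has only
  \<open>g\<close> lifts modulo \<open>g * m\<close>.\<close>

lemma mod_lift:
  fixes x d m :: int and g :: nat
  assumes "m > 0" "g > 0" "x mod m = d"
  shows "x mod (int g * m) \<in> (\<lambda>j. d + int j * m) ` {..<g}"
proof -
  define y where "y = x mod (int g * m)"
  have y: "0 \<le> y" "y < int g * m"
    using assms unfolding y_def by (auto intro!: pos_mod_sign pos_mod_bound)
  have "y mod m = d"
    using assms unfolding y_def by (simp add: mod_mod_cancel)
  then have "y = d + int (nat (y div m)) * m"
    using y(1) assms(1) div_mult_mod_eq[of y m] by (simp add: pos_imp_zdiv_nonneg_iff)
  moreover have "y div m < int g"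
  proof (rule ccontr)
    assume "\<not> y div m < int g"
    then have "int g * m \<le> y div m * m"
      using assms(1) by (intro mult_right_mono) auto
    then show False
      using y(2) assms(1) div_mult_mod_eq[of y m] pos_mod_sign[of m y] by linarith
  qed
  then have "nat (y div m) < g"
    using assms(2) by linarith
  ultimately show ?thesis
    unfolding y_def by blast
qed

section \<open>Reduction modulo \<open>M\<close>\<close>

text \<open>Keep one mark per residue class modulo \<open>M\<close>. A discarded mark and its kept
  partner give two ordered pairs whose differences are multiples of \<open>M\<close>; these
  differences are pairwise distinct, so twice the number of discarded marks is at most
  \<open>g\<close>.\<close>

lemma modular_golomb_ruler_card_mod_image:
  assumes A: "modular_golomb_ruler 1 (g * M) A" and "g > 0" "M > 0"
  obtains B where "B \<subseteq> A" "inj_on (\<lambda>x. x mod int M) B" "card A \<le> card B + g div 2"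
proof -
  let ?f = "\<lambda>x. x mod int M"
  have sub: "A \<subseteq> {0..<int (g * M)}"
    using A by (simp add: modular_golomb_ruler_def)
  then have fin: "finite A"
    using finite_subset by blast
  obtain B where B: "B \<subseteq> A" "inj_on ?f B" "?f ` A = ?f ` B"
    using subset_image_inj[of "?f ` A" ?f A] by auto
  define C where "C = A - B"
  have "\<exists>b\<in>B. ?f b = ?f c" if "c \<in> C" for c
  proof -
    have "?f c \<in> ?f ` B"
      using that unfolding C_def B(3)[symmetric] by blast
    then show ?thesis by force
  qed
  then obtain \<beta> where \<beta>: "\<beta> c \<in> B" "?f (\<beta> c) = ?f c" if "c \<in> C" for c
    by metis
  \<comment> \<open>Both orders are taken: this doubling is what yields \<open>g div 2\<close>
    rather than \<open>g\<close>.\<close>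
  define P where "P = (\<lambda>c. (c, \<beta> c)) ` C \<union> (\<lambda>c. (\<beta> c, c)) ` C"
  have finC: "finite C"
    using fin by (simp add: C_def)
  have "(\<lambda>c. (c, \<beta> c)) ` C \<inter> (\<lambda>c. (\<beta> c, c)) ` C = {}"
    using \<beta>(1) unfolding C_def by auto
  then have cardP: "card P = 2 * card C"
    unfolding P_def using finC
    by (simp add: card_Un_disjoint card_image inj_on_def)
  have "c \<in> A" "\<beta> c \<in> A" "\<beta> c \<noteq> c" if "c \<in> C" for c
    using \<beta>(1)[OF that] that B(1) by (auto simp: C_def)
  then have P: "x \<in> A \<and> y \<in> A \<and> x \<noteq> y \<and> ?f x = ?f y" if "(x, y) \<in> P" for x y
    using that \<beta>(2) unfolding P_def by (auto dest: sym)
  define \<delta> where "\<delta> = (\<lambda>(x, y). (x - y) mod int (g * M))"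
  have "inj_on \<delta> P"
  proof (rule inj_onI)
    fix p q assume "p \<in> P" "q \<in> P" "\<delta> p = \<delta> q"
    then show "p = q"
      using modular_golomb_ruler_1_unique[OF A, of "fst p" "snd p" "fst q" "snd q"]
        P[of "fst p" "snd p"] P[of "fst q" "snd q"]
      by (simp add: \<delta>_def case_prod_beta prod_eq_iff)
  qed
  \<comment> \<open>The multiple 0 is counted too, although distinct marks never produce it; the
    bound \<open>g\<close> is enough.\<close>
  moreover have "\<delta> ` P \<subseteq> (\<lambda>j. int j * int M) ` {..<g}"
  proof
    fix z assume "z \<in> \<delta> ` P"
    then obtain x y where "(x, y) \<in> P" and z: "z = (x - y) mod (int g * int M)"
      by (auto simp: \<delta>_def)
    then have "(x - y) mod int M = 0"
      using P[of x y] by (simp add: mod_eq_dvd_iff mod_eq_0_iff_dvd)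
    with mod_lift[of "int M" g "x - y" 0] assms(2,3) z
    show "z \<in> (\<lambda>j. int j * int M) ` {..<g}" by auto
  qed
  ultimately have "card P \<le> card ((\<lambda>j. int j * int M) ` {..<g})"
    by (rule card_inj_on_le) simp
  also have "\<dots> \<le> g"
    using card_image_le[of "{..<g}"] by simp
  finally have "card P \<le> g" .
  with cardP have "card C \<le> g div 2"
    by linarith
  moreover have "card A = card B + card C"
    unfolding C_def using B(1) fin
    by (metis card_Diff_subset card_mono finite_subset le_add_diff_inverse)
  ultimately show thesis
    using that B by simp
qed

text \<open>Each of the at most \<open>g\<close> lifts of a residue is the difference of at most one
  pair of marks.\<close>

lemma modular_golomb_ruler_mod_image:
  assumes B: "modular_golomb_ruler 1 (g * M) B" and "g > 0" "M > 0"
    and inj: "inj_on (\<lambda>x. x mod int M) B"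
  shows "modular_golomb_ruler g M ((\<lambda>x. x mod int M) ` B)"
proof -
  let ?f = "\<lambda>x. x mod int M"
  have "card {(t, t') \<in> ?f ` B \<times> ?f ` B. t \<noteq> t' \<and> (t - t') mod int M = d} \<le> g" for d
  proof -
    define Q where "Q = {(x, y) \<in> B \<times> B. x \<noteq> y \<and> (x - y) mod int M = d}"
    define \<delta> where "\<delta> = (\<lambda>(x, y). (x - y) mod int (g * M))"
    have "finite B"
      using B finite_subset by (auto simp: modular_golomb_ruler_def)
    then have finQ: "finite Q"
      by (intro finite_subset[of Q "B \<times> B"]) (auto simp: Q_def)
    have "inj_on \<delta> Q"
    proof (rule inj_onI)
      fix p q assume "p \<in> Q" "q \<in> Q" "\<delta> p = \<delta> q"
      then show "p = q"
        using modular_golomb_ruler_1_unique[OF B, of "fst p" "snd p" "fst q" "snd q"]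
        by (simp add: Q_def \<delta>_def case_prod_beta prod_eq_iff mem_Times_iff)
    qed
    moreover have "\<delta> ` Q \<subseteq> (\<lambda>j. d + int j * int M) ` {..<g}"
    proof
      fix z assume "z \<in> \<delta> ` Q"
      then obtain x y where "(x - y) mod int M = d" "z = (x - y) mod (int g * int M)"
        by (auto simp: \<delta>_def Q_def)
      with mod_lift[of "int M" g "x - y" d] assms(2,3)
      show "z \<in> (\<lambda>j. d + int j * int M) ` {..<g}" by auto
    qed
    ultimately have "card Q \<le> card ((\<lambda>j. d + int j * int M) ` {..<g})"
      by (rule card_inj_on_le) simp
    also have "\<dots> \<le> g"
      using card_image_le[of "{..<g}"] by simp
    finally have "card Q \<le> g" .
    have "{(t, t') \<in> ?f ` B \<times> ?f ` B. t \<noteq> t' \<and> (t - t') mod int M = d}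
        \<subseteq> (\<lambda>(x, y). (?f x, ?f y)) ` Q"
      by (auto simp: Q_def mod_diff_eq)
    then have "card {(t, t') \<in> ?f ` B \<times> ?f ` B. t \<noteq> t' \<and> (t - t') mod int M = d} \<le> card Q"
      using finQ by (meson card_image_le card_mono finite_imageI order_trans)
    with \<open>card Q \<le> g\<close> show ?thesis by linarith
  qed
  with assms(3) show ?thesis
    by (auto simp: modular_golomb_ruler_def)
qed

text \<open>The idea is to sum \<open>u t \<ge> a - (a - u t)\<close>, where the truncated difference \<open>a - u t\<close>
  exceeds \<open>0\<close> only on the fibres over \<open>0, \<dots>, a - 1\<close>.\<close>
lemma sum_ge_of_bounded_fibres:
  fixes u :: "'a \<Rightarrow> nat"
  assumes fin: "finite T" and fibre: "\<And>v. card {t \<in> T. u t = v} \<le> g"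
  shows "2 * (card T * a) \<le> 2 * (\<Sum>t\<in>T. u t) + g * (a * (a + 1))"
proof -
  \<comment> \<open>Doubling keeps the natural-number arithmetic free of division.\<close>
  have gauss: "2 * (\<Sum>v<a. a - v) = a * (a + 1)"
  proof (induction a)
    case (Suc b)
    have "(\<Sum>v<Suc b. Suc b - v) = (\<Sum>v<b. Suc (b - v)) + 1"
      by (simp add: Suc_diff_le)
    also have "\<dots> = (\<Sum>v<b. b - v) + b + 1"
      by (simp add: sum.distrib[of "\<lambda>v. b - v" "\<lambda>_. 1", simplified])
    finally show ?case using Suc by simp
  qed simp
  let ?L = "{t \<in> T. u t < a}"
  have "(\<Sum>t\<in>T. a - u t) = (\<Sum>t\<in>?L. a - u t)"
    using fin by (intro sum.mono_neutral_right) auto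
  also have "\<dots> = (\<Sum>v<a. \<Sum>t\<in>{t \<in> ?L. u t = v}. a - u t)"
    using fin by (intro sum.group[symmetric]) auto
  also have "\<dots> = (\<Sum>v<a. card {t \<in> T. u t = v} * (a - v))"
    by (intro sum.cong refl) (auto intro!: arg_cong[of _ _ card])
  also have "\<dots> \<le> (\<Sum>v<a. g * (a - v))"
    by (intro sum_mono mult_right_mono fibre) simp
  also have "\<dots> = g * (\<Sum>v<a. a - v)"
    by (simp add: sum_distrib_left)
  finally have *: "(\<Sum>t\<in>T. a - u t) \<le> g * (\<Sum>v<a. a - v)" .
  have "card T * a = (\<Sum>t\<in>T. a)"
    by simp
  also have "\<dots> \<le> (\<Sum>t\<in>T. u t + (a - u t))"
    by (intro sum_mono) simp
  also have "\<dots> \<le> (\<Sum>t\<in>T. u t) + g * (\<Sum>v<a. a - v)"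
    using * by (simp add: sum.distrib)
  finally have "2 * (card T * a) \<le> 2 * (\<Sum>t\<in>T. u t) + g * (2 * (\<Sum>v<a. a - v))"
    by simp
  then show ?thesis
    unfolding gauss .
qed

section \<open>Cyclic gaps between residues\<close>

text \<open>The distance from \<open>t\<close> to the next mark around the circle. Since
  \<open>d > 0\<close>, a lone mark has gap \<open>M\<close>, a full turn.\<close>

definition gap :: "nat \<Rightarrow> int set \<Rightarrow> int \<Rightarrow> nat" where
  "gap M T t = (LEAST d. d > 0 \<and> (t + int d) mod int M \<in> T)"

context
  fixes M :: nat and T :: "int set"
  assumes M: "M > 0" and T: "T \<subseteq> {0..<int M}"
begin

lemma mod_mem: "x \<in> T \<Longrightarrow> x mod int M = x"
  using subsetD[OF T] by simp

lemma gap_props: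
  assumes "t \<in> T"
  shows "gap M T t > 0" "(t + int (gap M T t)) mod int M \<in> T" "gap M T t \<le> M"
proof -
  \<comment> \<open>A full turn leads back to \<open>t\<close>, so the minimum exists.\<close>
  have *: "M > 0 \<and> (t + int M) mod int M \<in> T"
    using M T assms by auto
  show "gap M T t \<le> M"
    unfolding gap_def by (rule Least_le[of "\<lambda>d. d > 0 \<and> (t + int d) mod int M \<in> T", OF *])
  show "gap M T t > 0" "(t + int (gap M T t)) mod int M \<in> T"
    using LeastI[of "\<lambda>d. d > 0 \<and> (t + int d) mod int M \<in> T", OF *]
    unfolding gap_def by auto
qed

lemma gap_le:
  assumes "d > 0" "(t + int d) mod int M \<in> T"
  shows "gap M T t \<le> d"
  unfolding gap_def by (rule Least_le) (use assms in simp)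

text \<open>Every residue lies on one of the arcs \<open>t, t + 1, \<dots>, t + gap t - 1\<close>.\<close>
lemma sum_gap_ge:
  assumes "T \<noteq> {}"
  shows "M \<le> (\<Sum>t\<in>T. gap M T t)"
proof -
  have fin: "finite T"
    using T finite_subset by blast
  let ?arc = "\<lambda>t. (\<lambda>i. (t + int i) mod int M) ` {..<gap M T t}"
  have "{0..<int M} \<subseteq> (\<Union>t\<in>T. ?arc t)"
  proof
    fix x assume x: "x \<in> {0..<int M}"
    \<comment> \<open>Walk backwards from \<open>x\<close> to the nearest mark. Any mark
      \<open>s\<close> shows that the walk ends.\<close>
    define e where "e = (LEAST e. (x - int e) mod int M \<in> T)"
    obtain s where s: "s \<in> T" using assms by blast
    have "(x - int (nat ((x - s) mod int M))) mod int M = s mod int M"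
      using M by (simp add: mod_diff_right_eq)
    then have "(x - int (nat ((x - s) mod int M))) mod int M \<in> T"
      using s T by auto
    then have e: "(x - int e) mod int M \<in> T"
      unfolding e_def by (rule LeastI)
    have e_le: "e \<le> f" if "(x - int f) mod int M \<in> T" for f
      unfolding e_def by (rule Least_le) (rule that)
    define t where "t = (x - int e) mod int M"
    have t: "t \<in> T"
      using e by (simp add: t_def)
    \<comment> \<open>Otherwise the mark following \<open>t\<close> would be met earlier on the way
      back from \<open>x\<close>.\<close>
    have "e < gap M T t"
    proof (rule ccontr)
      assume "\<not> e < gap M T t"
      then have le: "gap M T t \<le> e" by simp
      have "(t + int (gap M T t)) mod int M = (x - int (e - gap M T t)) mod int M"
        using le by (simp add: t_def mod_add_left_eq mod_add_right_eq algebra_simps of_nat_diff)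
      then have "e \<le> e - gap M T t"
        using gap_props(2)[OF t] by (intro e_le) simp
      then show False
        using gap_props(1)[OF t] le by linarith
    qed
    moreover have "(t + int e) mod int M = x"
      using x by (simp add: t_def mod_add_left_eq)
    ultimately show "x \<in> (\<Union>t\<in>T. ?arc t)"
      using t by blast
  qed
  then have "card {0..<int M} \<le> card (\<Union>t\<in>T. ?arc t)"
    using fin by (intro card_mono) auto
  also have "\<dots> \<le> (\<Sum>t\<in>T. card (?arc t))"
    by (rule card_UN_le[OF fin])
  also have "\<dots> \<le> (\<Sum>t\<in>T. gap M T t)"
    by (intro sum_mono order_trans[OF card_image_le]) auto
  finally show ?thesis by simp
qed

text \<open>A gap \<open>v < M\<close> starting at \<open>t\<close> is a difference \<open>v\<close>
  between the next mark and \<open>t\<close>, and \<open>t\<close> determines this pair. A gap equal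
  to \<open>M\<close> is not a nonzero residue and is treated apart.\<close>

lemma card_gap_fibre_le:
  assumes "modular_golomb_ruler g M T" "g > 0"
  shows "card {t \<in> T. gap M T t = v} \<le> g"
proof (cases "v < M \<and> {t \<in> T. gap M T t = v} \<noteq> {}")
  case True
  let ?P = "{(a, a') \<in> T \<times> T. a \<noteq> a' \<and> (a - a') mod int M = int v}"
  have fin: "finite T"
    using T finite_subset by blast
  have v: "int v \<in> {1..<int M}"
    using True gap_props(1) by fastforce
  have "((t + int v) mod int M, t) \<in> ?P" if "t \<in> T" "gap M T t = v" for t
  proof -
    have "((t + int v) mod int M - t) mod int M = int v"
      using v by (simp add: mod_diff_left_eq)
    moreover from this have "(t + int v) mod int M \<noteq> t"
      using v by auto
    ultimately show ?thesis
      using gap_props(2)[OF that(1)] that by simp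
  qed
  then have "(\<lambda>t. ((t + int v) mod int M, t)) ` {t \<in> T. gap M T t = v} \<subseteq> ?P"
    by blast
  moreover have "finite ?P"
    by (rule finite_subset[of _ "T \<times> T"]) (use fin in auto)
  ultimately have "card {t \<in> T. gap M T t = v} \<le> card ?P"
    by (intro card_inj_on_le[of "\<lambda>t. ((t + int v) mod int M, t)"]) (auto simp: inj_on_def)
  also have "\<dots> \<le> g"
    using assms(1) v by (simp add: modular_golomb_ruler_def)
  finally show ?thesis .
next
  case False
  have fin: "finite {t \<in> T. gap M T t = v}"
    using T finite_subset[of T] by simp
  \<comment> \<open>A second mark would cut the gap of \<open>t\<close> below \<open>M\<close>, so a
    nonempty fibre in this case is a single mark.\<close>
  have "s = t" if "s \<in> T" "t \<in> T" "gap M T s = v" "gap M T t = v" for s t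
  proof (rule ccontr)
    assume "s \<noteq> t"
    then have d: "(s - t) mod int M \<in> {1..<int M}"
      using that T by (intro mod_diff_pos) auto
    have "(t + int (nat ((s - t) mod int M))) mod int M = s"
      using d that(1) T by (auto simp: mod_add_right_eq)
    then have "gap M T t \<le> nat ((s - t) mod int M)"
      using d that(1) by (intro gap_le) auto
    also have "\<dots> < M"
      using d by auto
    finally show False
      using False that by auto
  qed
  then have "card {t \<in> T. gap M T t = v} \<le> Suc 0"
    unfolding card_le_Suc0_iff_eq[OF fin] by blast
  with assms(2) show ?thesis by linarith
qed

text \<open>Rotate the circle so that the mark ending the gap lands on 0. The gap then fills the end
  of \<open>{0..<int M}\<close>, and integer differences of the rotated marks are differences modulo
  \<open>M\<close>.\<close>

lemma golomb_ruler_cut_at_gap: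
  assumes "modular_golomb_ruler g M T" "t \<in> T"
  obtains S where "golomb_ruler g S" "card S = card T" "diameter S \<le> int M - int (gap M T t)"
proof -
  define D where "D = gap M T t"
  define h where "h = (\<lambda>x. (x - t - int D) mod int M)"
  define S where "S = h ` T"
  have fin: "finite T"
    using T finite_subset by blast
  then have finS: "finite S"
    by (simp add: S_def)
  have inj: "inj_on h T"
  proof (rule inj_onI)
    fix x y assume "x \<in> T" "y \<in> T" "h x = h y"
    then have "x mod int M = y mod int M"
      by (simp add: h_def mod_eq_dvd_iff)
    with \<open>x \<in> T\<close> \<open>y \<in> T\<close> show "x = y" by (simp add: mod_mem)
  qed
  have S_bounds: "0 \<le> s \<and> s \<le> int M - int D" if s_mem: "s \<in> S" for s
  proof -
    obtain x where x: "x \<in> T" "s = h x"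
      using s_mem by (auto simp: S_def)
    have s: "0 \<le> s" "s < int M"
      using x M by (simp_all add: h_def)
    have "s \<le> int M - int D"
    proof (rule ccontr)
      assume *: "\<not> s \<le> int M - int D"
      \<comment> \<open>A mark beyond \<open>M - D\<close> would sit at \<open>t + e\<close> with
        \<open>0 < e < D\<close>, strictly inside the gap.\<close>
      define e where "e = nat (s - (int M - int D))"
      have e: "int e = s + int D - int M" "e > 0" "e < D"
        using * s by (auto simp: e_def)
      have "(t + int e) mod int M = (t + (s + int D)) mod int M"
        unfolding e(1) by (simp add: mod_eq_dvd_iff)
      also have "\<dots> = (s + (t + int D)) mod int M"
        by (simp add: algebra_simps)
      also have "\<dots> = x mod int M"
        unfolding x(2) h_def by (simp add: mod_add_left_eq)
      finally have "(t + int e) mod int M \<in> T"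
        using x(1) T by auto
      from gap_le[OF e(2) this] e(3) show False
        by (simp add: D_def)
    qed
    with s show ?thesis by simp
  qed
  have D: "D > 0"
    using gap_props(1)[OF assms(2)] by (simp add: D_def)
  have "card {(a, c) \<in> S \<times> S. c - a = d} \<le> g" if "d > 0" for d
  proof (cases "d < int M")
    case True
    let ?P = "{(a, a') \<in> T \<times> T. a \<noteq> a' \<and> (a - a') mod int M = d}"
    have "finite ?P"
      by (rule finite_subset[of _ "T \<times> T"]) (use fin in auto)
    moreover have "{(a, c) \<in> S \<times> S. c - a = d} \<subseteq> (\<lambda>(x, y). (h y, h x)) ` ?P"
    proof safe
      fix a c assume "a \<in> S" "c \<in> S" and d: "d = c - a"
      then obtain x y where xy: "x \<in> T" "y \<in> T" "c = h x" "a = h y"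
        by (auto simp: S_def)
      have "(x - y) mod int M = (h x - h y) mod int M"
        unfolding h_def by (simp add: mod_diff_eq)
      then have "(x - y) mod int M = c - a"
        using xy d True \<open>d > 0\<close> by simp
      moreover have "x \<noteq> y"
        using xy d \<open>d > 0\<close> by auto
      ultimately show "(a, c) \<in> (\<lambda>(x, y). (h y, h x))
          ` {(x, y) \<in> T \<times> T. x \<noteq> y \<and> (x - y) mod int M = c - a}"
        using xy by force
    qed
    ultimately have "card {(a, c) \<in> S \<times> S. c - a = d} \<le> card ?P"
      by (meson card_image_le card_mono finite_imageI order_trans)
    also have "\<dots> \<le> g"
      using assms(1) True \<open>d > 0\<close> by (simp add: modular_golomb_ruler_def)
    finally show ?thesis .
  next
    case False
    \<comment> \<open>As \<open>D > 0\<close>, the rotated marks span less than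
      \<open>M\<close>.\<close>
    have "c - a \<noteq> d" if "a \<in> S" "c \<in> S" for a c
      using S_bounds[OF that(1)] S_bounds[OF that(2)] D False by linarith
    then have "{(a, c) \<in> S \<times> S. c - a = d} = {}" by blast
    then show ?thesis by (simp only: card.empty)
  qed
  then have "golomb_ruler g S"
    using finS by (simp add: golomb_ruler_def)
  moreover have "card S = card T"
    unfolding S_def by (rule card_image[OF inj])
  moreover have "S \<noteq> {}"
    using assms(2) by (auto simp: S_def)
  then have "diameter S \<le> int M - int D"
    unfolding diameter_def using S_bounds[OF Max_in[OF finS]] S_bounds[OF Min_in[OF finS]]
    by linarith
  ultimately show thesis
    using that by (simp add: D_def)
qed

end

section \<open>The largest gap and the final bound\<close>

text \<open>Apply the fibre bound to the deficits \<open>D - gap M T s\<close> from the largest gap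
  \<open>D\<close>: their fibres are fibres of the gaps, and the deficits and gaps together sum to
  \<open>card T * D\<close>. The parameter \<open>a\<close> is arbitrary here.\<close>

lemma modular_golomb_ruler_large_gap:
  assumes "modular_golomb_ruler g M T" "g > 0" "M > 0" "T \<noteq> {}"
  obtains t where "t \<in> T"
    "2 * int M + 2 * int (card T) * int a
      \<le> 2 * int (card T) * int (gap M T t) + int g * (int a * (int a + 1))"
proof -
  have T: "T \<subseteq> {0..<int M}"
    using assms(1) by (simp add: modular_golomb_ruler_def)
  then have fin: "finite T"
    using finite_subset by blast
  define D where "D = Max (gap M T ` T)"
  have "D \<in> gap M T ` T"
    unfolding D_def using fin assms(4) by (intro Max_in) auto
  then obtain t where t: "t \<in> T" "gap M T t = D"
    by auto
  have le: "gap M T s \<le> D" if "s \<in> T" for s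
    unfolding D_def using fin that by (intro Max_ge) auto
  have "card {s \<in> T. D - gap M T s = v} \<le> g" for v
  proof -
    have "{s \<in> T. D - gap M T s = v} \<subseteq> {s \<in> T. gap M T s = D - v}"
      using le by auto
    then have "card {s \<in> T. D - gap M T s = v} \<le> card {s \<in> T. gap M T s = D - v}"
      using fin by (intro card_mono) auto
    also have "\<dots> \<le> g"
      by (rule card_gap_fibre_le[OF assms(3) T assms(1,2)])
    finally show ?thesis .
  qed
  from sum_ge_of_bounded_fibres[OF fin this, where a = a]
  have "2 * (card T * a) \<le> 2 * (\<Sum>s\<in>T. D - gap M T s) + g * (a * (a + 1))" .
  moreover have "(\<Sum>s\<in>T. D - gap M T s) + (\<Sum>s\<in>T. gap M T s) = card T * D"
    using le by (simp add: sum.distrib[symmetric])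
  moreover have "M \<le> (\<Sum>s\<in>T. gap M T s)"
    by (rule sum_gap_ge[OF assms(3) T assms(4)])
  ultimately have "2 * M + 2 * (card T * a) \<le> 2 * (card T * D) + g * (a * (a + 1))"
    by linarith
  then have "int (2 * M + 2 * (card T * a)) \<le> int (2 * (card T * D) + g * (a * (a + 1)))"
    by (simp only: of_nat_le_iff)
  then show thesis
    using that[OF t(1)] t(2) by (simp add: algebra_simps)
qed

theorem theorem3:
  fixes N k g n :: nat and a r :: int
  assumes "N > 0" "k > 0" "g > 0" "n > 0"
    and "\<exists>A. modular_golomb_ruler 1 N A \<and> card A = k"
    and "g dvd N"
    and "int n \<le> int k - \<lfloor>real g / 2\<rfloor>"
    and "int n = a * int g + r" "0 \<le> r" "r < int g"
  shows "let bound = real N / real g -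
           real_of_int \<lceil>(real N / real g
             + real g * real_of_int a * (real_of_int a - 1) / 2
             + real_of_int r * real_of_int a) / real n\<rceil>
         in real (golomb_G g n) \<le> bound \<and>
            (\<forall>g'\<ge>g. real (golomb_G g' n) \<le> bound)"
proof -
  obtain A where A: "modular_golomb_ruler 1 N A" "card A = k"
    using assms(5) by blast
  obtain M where N: "N = g * M"
    using assms(6) by blast
  then have M: "M > 0"
    using assms(1) by simp
  obtain B where B: "B \<subseteq> A" "inj_on (\<lambda>x. x mod int M) B" "card A \<le> card B + g div 2"
    using modular_golomb_ruler_card_mod_image[of g M A] A(1) assms(3) M N by blast
  have "\<lfloor>real g / 2\<rfloor> = int (g div 2)"
    using floor_divide_of_nat_eq[of g 2] by simp
  then have "n \<le> card B"
    using assms(7) B(3) A(2) by linarith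
  \<comment> \<open>\<open>B\<close> may have more than \<open>n\<close> marks; the surplus is
    dropped.\<close>
  then obtain B' where B': "B' \<subseteq> B" "card B' = n"
    by (metis obtain_subset_with_card_n)
  define T where "T = (\<lambda>x. x mod int M) ` B'"
  have inj: "inj_on (\<lambda>x. x mod int M) B'"
    using B(2) B'(1) inj_on_subset by blast
  have T: "modular_golomb_ruler g M T"
    unfolding T_def
    using modular_golomb_ruler_subset[OF A(1), of B'] B(1) B'(1) N assms(3) M inj
    by (intro modular_golomb_ruler_mod_image) auto
  have card_T: "card T = n"
    unfolding T_def using card_image[OF inj] B'(2) by simp
  then have "T \<noteq> {}"
    using assms(4) by auto
  \<comment> \<open>A negative quotient would give \<open>n \<le> r - g < 0\<close>.\<close>
  have "a \<ge> 0"
  proof (rule ccontr)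
    assume "\<not> a \<ge> 0"
    then have "a * int g \<le> - 1 * int g"
      by (intro mult_right_mono) auto
    with assms(4,8,10) show False by linarith
  qed
  then obtain b where b: "a = int b"
    using nonneg_int_cases by blast
  \<comment> \<open>The free parameter is set to the quotient of \<open>n\<close> by
    \<open>g\<close>.\<close>
  obtain t where t: "t \<in> T"
    "2 * int M + 2 * int n * a \<le> 2 * int n * int (gap M T t) + int g * (a * (a + 1))"
    using modular_golomb_ruler_large_gap[OF T assms(3) M \<open>T \<noteq> {}\<close>, of b] card_T b by metis
  obtain S where S: "golomb_ruler g S" "card S = n" "diameter S \<le> int M - int (gap M T t)"
    using golomb_ruler_cut_at_gap[OF M _ T t(1)] T card_T
    by (auto simp: modular_golomb_ruler_def)
  have G: "real (golomb_G g' n) \<le> real M - real (gap M T t)" if "g' \<ge> g" for g'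
    using golomb_G_le[OF golomb_ruler_mono[OF S(1) that] S(2) assms(4) S(3)] by linarith
  define X where "X = real M + real g * real_of_int a * (real_of_int a - 1) / 2
    + real_of_int r * real_of_int a"
  have le: "real_of_int (2 * int M + 2 * int n * a)
      \<le> real_of_int (2 * int n * int (gap M T t) + int g * (a * (a + 1)))"
    using t(2) by (simp only: of_int_le_iff)
  have n: "real n = real_of_int a * real g + real_of_int r"
    using arg_cong[OF assms(8), of real_of_int] by simp
  \<comment> \<open>Substituting \<open>n = a g + r\<close> turns \<open>2 n a - g a (a + 1)\<close>
    into \<open>g a (a - 1) + 2 r a\<close>, twice the correction in \<open>X\<close>.\<close>
  have "real n * real_of_int a
      = real_of_int a * real g * real_of_int a + real_of_int r * real_of_int a"
    unfolding n by (simp add: algebra_simps)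
  moreover have "2 * real M + 2 * (real n * real_of_int a) \<le> 2 * (real (gap M T t) * real n)
      + real_of_int a * real g * real_of_int a + real g * real_of_int a"
    using le by (simp add: algebra_simps)
  moreover have "2 * X = 2 * real M + real_of_int a * real g * real_of_int a
      - real g * real_of_int a + 2 * (real_of_int r * real_of_int a)"
    unfolding X_def by (simp add: field_simps)
  ultimately have "X \<le> real (gap M T t) * real n"
    by linarith
  then have "X / real n \<le> real_of_int (int (gap M T t))"
    using assms(4) by (simp add: pos_divide_le_eq)
  \<comment> \<open>The gap is an integer, so the lower bound rounds up.\<close>
  then have "\<lceil>X / real n\<rceil> \<le> int (gap M T t)"
    by (simp only: ceiling_le_iff)
  then have "real (golomb_G g' n) \<le> real M - real_of_int \<lceil>X / real n\<rceil>" if "g' \<ge> g" for g'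
    using G[OF that] by linarith
  moreover have "real N / real g = real M"
    using N assms(3) by simp
  ultimately show ?thesis
    unfolding Let_def X_def by simp
qed

end
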